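(* For every nonnegative integer $n$, $$\sum_{k=1}^{\infty}\frac{1}{(2k+1)^{n+1}}\binom{2k}{k}\frac{1}{4^k}=\frac{(-1)^n}{n!}\int_0^{\pi/2}\bigl(\ln\sin x\bigr)^n\,dx-1.$$ *)

theory Defs
  imports "HOL-Analysis.Analysis"
begin

end

theory Submission
  imports Defs "HOL-Real_Asymp.Real_Asymp"
begin

text \<open>
  On $(0, \pi/2)$ the binomial series of $(1 - \sin^2 x)^{-1/2}$ gives
  $1 = \sum_k \binom{2k}{k} 4^{-k} \sin^{2k} x \cos x$. Multiply by $(-\ln \sin x)^n$ and
  integrate term by term: the substitution $u = \sin x$ turns the $k$-th integral into
  $\int_0^1 u^{2k} (-\ln u)^n\,du = n!/(2k+1)^{n+1}$. All terms are nonnegative, so monotone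
  convergence applies once the partial sums of the integrals are bounded. For $n = 0$ they are
  at most $\pi/2$, and for general $n$ they are at most $n!$ times those for $n = 0$.
\<close>

text \<open>Only u = 0 is delicate. One factor u already beats every power of the logarithm, and the
  positive exponent \<open>Suc m\<close> makes the value there 0 whatever \<open>ln 0\<close> is.
  This gives the boundary term of the integration by parts below.\<close>

lemma continuous_on_power_mult_ln_power:
  fixes m j :: nat
  shows "continuous_on {0..} (\<lambda>u::real. u ^ Suc m * (- ln u) ^ j)"
proof -
  have "continuous (at u within {0..}) (\<lambda>u::real. u ^ Suc m * (- ln u) ^ j)" if "u \<ge> 0" for u
  proof (cases "u = 0")
    case True
    have "((\<lambda>u::real. u * (- ln u) ^ j) \<longlongrightarrow> 0) (at_right 0)"
      by real_asymp
    moreover have "((\<lambda>u::real. u ^ m) \<longlongrightarrow> 0 ^ m) (at_right 0)"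
      by (intro tendsto_intros)
    ultimately have "((\<lambda>u::real. u ^ m * (u * (- ln u) ^ j)) \<longlongrightarrow> 0 ^ m * 0) (at_right 0)"
      by (intro tendsto_mult)
    \<comment> \<open>Both filters exclude the point 0 itself.\<close>
    moreover have "at 0 within {0..} = at_right (0::real)"
      by (auto simp: at_within_def intro!: arg_cong2[where f = inf] arg_cong[where f = principal])
    ultimately show ?thesis
      using True by (simp add: continuous_within mult_ac)
  next
    case False
    with that have "isCont (\<lambda>u::real. u ^ Suc m * (- ln u) ^ j) u"
      by (intro continuous_intros) auto
    then show ?thesis
      by (rule continuous_at_imp_continuous_at_within)
  qed
  then show ?thesis
    by (auto simp: continuous_on_eq_continuous_within)
qed

text \<open>A primitive, rather than an integral, can be composed with \<open>sin\<close> directly.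
  It is required to be continuous up to 0 but differentiable only for u > 0, since the integrand may
  be unbounded near 0.\<close>

lemma power_mult_ln_power_primitive:
  fixes m n :: nat
  shows "\<exists>G :: real \<Rightarrow> real. continuous_on {0..} G \<and> G 0 = 0 \<and> G 1 = fact n / real (Suc m) ^ Suc n \<and>
    (\<forall>u>0. (G has_real_derivative u ^ m * (- ln u) ^ n) (at u))"
proof (induction n)
  case 0
  show ?case
  proof (intro exI[of _ "\<lambda>u. u ^ Suc m / real (Suc m)"] conjI allI impI)
    show "((\<lambda>u. u ^ Suc m / real (Suc m)) has_real_derivative u ^ m * (- ln u) ^ 0) (at u)" for u :: real
      by (rule derivative_eq_intros refl | simp)+
  qed (auto intro!: continuous_intros)
next
  case (Suc n)
  then obtain G :: "real \<Rightarrow> real" where G: "continuous_on {0..} G" "G 0 = 0"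
      "G 1 = fact n / real (Suc m) ^ Suc n"
      "\<And>u. u > 0 \<Longrightarrow> (G has_real_derivative u ^ m * (- ln u) ^ n) (at u)"
    by blast
  \<comment> \<open>integration by parts\<close>
  define H where "H = (\<lambda>u. (u ^ Suc m * (- ln u) ^ Suc n + real (Suc n) * G u) / real (Suc m))"
  have "(H has_real_derivative u ^ m * (- ln u) ^ Suc n) (at u)" if "u > 0" for u
  proof -
    have "(H has_real_derivative
        ((real (Suc m) * u ^ m * (- ln u) ^ Suc n
          + u ^ Suc m * (real (Suc n) * (- ln u) ^ n * (- (1 / u))))
          + real (Suc n) * (u ^ m * (- ln u) ^ n)) / real (Suc m)) (at u)"
      unfolding H_def using that
      by (auto intro!: derivative_eq_intros G(4) simp del: power_Suc of_nat_Suc)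
    \<comment> \<open>Differentiating the logarithm produces the term that the summand
      \<open>real (Suc n) * G u\<close> of \<open>H\<close> cancels.\<close>
    also have "u ^ Suc m * (real (Suc n) * (- ln u) ^ n * (- (1 / u)))
        = - (real (Suc n) * (u ^ m * (- ln u) ^ n))"
      using that by simp
    finally show ?thesis
      by (simp del: power_Suc of_nat_Suc)
  qed
  moreover have "continuous_on {0..} H"
    unfolding H_def
    by (intro continuous_intros G(1) continuous_on_power_mult_ln_power) simp
  \<comment> \<open>The boundary term vanishes at both ends: at 0 by the factor u, at 1 because
    \<open>ln 1 = 0\<close>.\<close>
  moreover have "H 0 = 0" "H 1 = fact (Suc n) / real (Suc m) ^ Suc (Suc n)"
    using G by (simp_all add: H_def mult_ac)
  ultimately show ?case
    by blast
qed

lemma has_integral_sin_power_ln_sin_power_cos: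
  fixes m n :: nat
  shows "((\<lambda>x. sin x ^ m * (- ln (sin x)) ^ n * cos x) has_integral
    fact n / real (Suc m) ^ Suc n) {0<..<pi/2}"
proof -
  obtain G :: "real \<Rightarrow> real" where G: "continuous_on {0..} G" "G 0 = 0"
      "G 1 = fact n / real (Suc m) ^ Suc n"
      "\<And>u. u > 0 \<Longrightarrow> (G has_real_derivative u ^ m * (- ln u) ^ n) (at u)"
    using power_mult_ln_power_primitive[of n m] by blast
  have "((\<lambda>x. sin x ^ m * (- ln (sin x)) ^ n * cos x) has_integral
      G (sin (pi/2)) - G (sin 0)) {0..pi/2}"
  \<comment> \<open>The primitive is \<open>G\<close> composed with \<open>sin\<close>; its
    derivative is needed only inside the interval, which avoids the singularity at x = 0.\<close>
  proof (rule fundamental_theorem_of_calculus_interior)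
    show "continuous_on {0..pi/2} (\<lambda>x. G (sin x))"
      by (rule continuous_on_compose2[OF G(1)]) (auto intro!: continuous_intros sin_ge_zero)
    show "((\<lambda>x. G (sin x)) has_vector_derivative sin x ^ m * (- ln (sin x)) ^ n * cos x) (at x)"
      if "x \<in> {0<..<pi/2}" for x
      using that DERIV_chain2[OF G(4) DERIV_sin, of x] sin_gt_zero[of x]
      by (simp add: has_real_derivative_iff_has_vector_derivative)
  qed simp
  then show ?thesis
    using G by (simp add: has_integral_Icc_iff_Ioo)
qed

text \<open>Both sides are 1 at k = 0 and are multiplied by (2k + 1) / (2k + 2) when k increases by
  one.\<close>

lemma central_binomial_eq_gbinomial:
  "real ((2 * k) choose k) / 4 ^ k = (-1) ^ k * ((- 1 / 2) gchoose k)"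
proof (induction k)
  case (Suc k)
  have "Suc k * (Suc (Suc (2 * k)) choose Suc k) = 2 * Suc k * (Suc (2 * k) choose k)"
    by (subst Suc_times_binomial) simp
  then have "(2 * Suc k) choose Suc k = 2 * (Suc (2 * k) choose k)"
    unfolding mult.assoc mult.left_commute[of 2 "Suc k"] mult_cancel1 by simp
  \<comment> \<open>By symmetry k may be replaced by k + 1 in the lower index on the left; then the
    absorption identity applies.\<close>
  moreover have "Suc k * (Suc (2 * k) choose k) = Suc (2 * k) * (2 * k choose k)"
    using Suc_times_binomial_add[of k k] Suc_times_binomial[of k "2 * k"] by (simp add: mult_2)
  ultimately have "Suc k * ((2 * Suc k) choose Suc k) = 2 * Suc (2 * k) * (2 * k choose k)"
    by (simp only: mult.assoc mult.left_commute[of "Suc k" 2])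
  then have "real (Suc k * ((2 * Suc k) choose Suc k)) = real (2 * Suc (2 * k) * (2 * k choose k))"
    by (rule arg_cong)
  then have central: "real ((2 * Suc k) choose Suc k)
      = 2 * (2 * real k + 1) * real (2 * k choose k) / (real k + 1)"
    by (simp add: field_simps del: binomial_Suc_Suc mult_Suc_right)
  have "(- 1 / 2 :: real) gchoose Suc k = (- 1 / 2 - real k) * ((- 1 / 2) gchoose k) / (real k + 1)"
    using gbinomial_mult_1[of "- 1 / 2 :: real" k] by (simp add: field_simps)
  then have "(- 1) ^ Suc k * ((- 1 / 2 :: real) gchoose Suc k)
      = (real k + 1 / 2) * ((- 1) ^ k * ((- 1 / 2) gchoose k)) / (real k + 1)"
    by (simp add: algebra_simps)
  also note Suc.IH[symmetric]
  finally have "(- 1) ^ Suc k * ((- 1 / 2 :: real) gchoose Suc k)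
      = (real k + 1 / 2) * (real ((2 * k) choose k) / 4 ^ k) / (real k + 1)" .
  moreover have "real k + 1 \<noteq> 0"
    by linarith
  ultimately show ?case
    unfolding central by (simp add: divide_simps) (simp add: algebra_simps)
qed simp

lemma central_binomial_sums:
  fixes z :: real
  assumes "\<bar>z\<bar> < 1"
  shows "(\<lambda>k. real ((2 * k) choose k) / 4 ^ k * z ^ k) sums (1 / sqrt (1 - z))"
proof -
  have "(\<lambda>k. ((- 1 / 2) gchoose k) * (- z) ^ k) sums (1 + - z) powr (- 1 / 2)"
    using assms by (intro gen_binomial_real) auto
  also have "(\<lambda>k. ((- 1 / 2) gchoose k) * (- z) ^ k) = (\<lambda>k. real ((2 * k) choose k) / 4 ^ k * z ^ k)"
    unfolding central_binomial_eq_gbinomial by (rule ext) (simp add: power_minus[of z] mult_ac)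
  also have "(1 + - z) powr (- 1 / 2) = 1 / sqrt (1 - z)"
    using assms by (simp add: powr_minus_divide powr_half_sqrt)
  finally show ?thesis .
qed

text \<open>At z = sin^2 x the series sums to 1 / |cos x|, and cos x is positive on this
  interval.\<close>

lemma central_binomial_sin_cos_sums:
  assumes "x \<in> {0<..<pi/2}"
  shows "(\<lambda>k. real ((2 * k) choose k) / 4 ^ k * sin x ^ (2 * k) * cos x) sums 1"
proof -
  have "cos x > 0"
    using assms by (auto intro: cos_gt_zero_pi)
  moreover from this have "(sin x)\<^sup>2 < 1"
    by (simp add: sin_squared_eq)
  ultimately show ?thesis
    using sums_mult2[OF central_binomial_sums[of "(sin x)\<^sup>2"], of "cos x"]
    by (simp add: cos_squared_eq[symmetric] power_mult)
qed

theorem theorem1: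
  fixes n :: nat
  shows "(\<lambda>x::real. (ln (sin x)) ^ n) integrable_on {0<..pi/2} \<and>
    (\<lambda>k. 1 / (2 * real (k + 1) + 1) ^ (n + 1) * real ((2 * (k + 1)) choose (k + 1)) * (1 / 4 ^ (k + 1)))
      sums ((-1) ^ n / fact n * integral {0<..pi/2} (\<lambda>x::real. (ln (sin x)) ^ n) - 1)"
proof -
  define c where "c k = real ((2 * k) choose k) / 4 ^ k" for k
  define S where "S n N x = (\<Sum>k<N. c k * (sin x ^ (2 * k) * (- ln (sin x)) ^ n * cos x))" for n N x
  define I where "I n N = (\<Sum>k<N. c k * (fact n / real (Suc (2 * k)) ^ Suc n))" for n N
  let ?D = "{0<..<pi/2}"
  have c_nonneg: "c k \<ge> 0" for k
    by (simp add: c_def)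
  have S_integral: "(S n N has_integral I n N) ?D" for n N
    unfolding S_def I_def
    by (intro has_integral_sum has_integral_mult_right has_integral_sin_power_ln_sin_power_cos) auto
  have pos: "sin x > 0" "cos x > 0" "- ln (sin x) \<ge> 0" if "x \<in> ?D" for x
    using that by (auto intro: sin_gt_zero cos_gt_zero_pi simp: ln_le_zero_iff sin_gt_zero)
  have S_eq: "S n N x = (\<Sum>k<N. c k * sin x ^ (2 * k) * cos x) * (- ln (sin x)) ^ n" for n N x
    unfolding S_def sum_distrib_right by (simp add: mult_ac)
  have S_lim: "(\<lambda>N. S n N x) \<longlonglongrightarrow> (- ln (sin x)) ^ n" if "x \<in> ?D" for n x
    using tendsto_mult_right[OF central_binomial_sin_cos_sums[OF that, unfolded sums_def], of "(- ln (sin x)) ^ n"]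
    by (simp add: S_eq c_def)
  have S_mono: "S n N x \<le> S n (Suc N) x" if "x \<in> ?D" for n N x
    using pos[OF that] c_nonneg[of N] by (simp add: S_def)
  \<comment> \<open>For n = 0 the partial sums increase pointwise to 1, so each is at most 1 on an
    interval of length pi/2.\<close>
  have I_0: "I 0 N \<le> pi/2" for N
  proof (rule has_integral_le[OF S_integral])
    show "((\<lambda>x. 1) has_integral pi/2) ?D"
      using has_integral_const_real[of "1::real" 0 "pi/2"] by (simp add: has_integral_Icc_iff_Ioo)
    show "S 0 N x \<le> 1" if "x \<in> ?D" for x
      using incseq_le[OF incseq_SucI S_lim[OF that, of 0], OF S_mono[OF that]] by simp
  qed
  have I_nonneg: "I n N \<ge> 0" for N
    unfolding I_def using c_nonneg by (intro sum_nonneg) auto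
  have I_bound: "I n N \<le> fact n * (pi/2)" for N
  proof -
    have "I n N \<le> fact n * I 0 N"
      unfolding I_def sum_distrib_left
    proof (rule sum_mono)
      fix k
      \<comment> \<open>Since 2k + 1 \<ge> 1, raising the exponent of the denominator only shrinks
        the term.\<close>
      have "real (Suc (2 * k)) ^ 1 \<le> real (Suc (2 * k)) ^ Suc n"
        by (rule power_increasing) auto
      then have "c k * (fact n / real (Suc (2 * k)) ^ Suc n) \<le> c k * (fact n / real (Suc (2 * k)) ^ 1)"
        by (intro mult_left_mono divide_left_mono c_nonneg) auto
      then show "c k * (fact n / real (Suc (2 * k)) ^ Suc n) \<le> fact n * (c k * (fact 0 / real (Suc (2 * k)) ^ Suc 0))"
        by (simp add: mult_ac)
    qed
    also have "\<dots> \<le> fact n * (pi/2)"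
      by (intro mult_left_mono I_0) auto
    finally show ?thesis .
  qed
  have *: "(\<lambda>x. (- ln (sin x)) ^ n) integrable_on ?D \<and>
      (\<lambda>N. integral ?D (S n N)) \<longlonglongrightarrow> integral ?D (\<lambda>x. (- ln (sin x)) ^ n)"
  proof (rule monotone_convergence_increasing)
    show "bounded (range (\<lambda>N. integral ?D (S n N)))"
      using I_bound I_nonneg unfolding integral_unique[OF S_integral]
      by (intro boundedI[of _ "fact n * (pi/2)"]) auto
  qed (use S_integral S_mono S_lim in auto)
  have sign: "(- 1) ^ n * (- ln (sin x)) ^ n = ln (sin x) ^ n" for x :: real
    by (simp flip: power_mult_distrib)
  \<comment> \<open>The half-open interval of the theorem differs from the open one by the null set
    {pi/2}.\<close>
  have Ioc: "((f has_integral y) {0<..pi/2}) = ((f has_integral y) ?D)" for f :: "real \<Rightarrow> real" and y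
    by (rule has_integral_spike_set_eq) (auto intro: negligible_subset[of "{pi/2}"])
  have "((\<lambda>x. ln (sin x) ^ n) has_integral (- 1) ^ n * integral ?D (\<lambda>x. (- ln (sin x)) ^ n)) {0<..pi/2}"
    unfolding Ioc sign[symmetric] using * by (intro has_integral_mult_right integrable_integral) auto
  note result = has_integral_integrable[OF this] integral_unique[OF this]
  have "(\<lambda>N. I n N / fact n) \<longlonglongrightarrow> integral ?D (\<lambda>x. (- ln (sin x)) ^ n) / fact n"
    using * by (intro tendsto_divide) (auto simp: integral_unique[OF S_integral])
  also have "(\<lambda>N. I n N / fact n) = (\<lambda>N. \<Sum>k<N. c k / real (Suc (2 * k)) ^ Suc n)"
    by (simp add: I_def sum_divide_distrib)
  also have "integral ?D (\<lambda>x. (- ln (sin x)) ^ n) / fact n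
      = (-1) ^ n / fact n * integral {0<..pi/2} (\<lambda>x::real. (ln (sin x)) ^ n)"
    unfolding result by (simp flip: power_mult_distrib)
  finally have "(\<lambda>k. c k / real (Suc (2 * k)) ^ Suc n) sums
      ((-1) ^ n / fact n * integral {0<..pi/2} (\<lambda>x::real. (ln (sin x)) ^ n))"
    unfolding sums_def .
  \<comment> \<open>Starting at k = 1 drops the term for k = 0, which equals 1; this is the -1 in
    the result.\<close>
  then have "(\<lambda>k. c (Suc k) / real (Suc (2 * Suc k)) ^ Suc n) sums
      ((-1) ^ n / fact n * integral {0<..pi/2} (\<lambda>x::real. (ln (sin x)) ^ n) - 1)"
    by (subst sums_Suc_iff) (simp add: c_def)
  moreover have "(\<lambda>k. c (Suc k) / real (Suc (2 * Suc k)) ^ Suc n) =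
      (\<lambda>k. 1 / (2 * real (k + 1) + 1) ^ (n + 1) * real ((2 * (k + 1)) choose (k + 1)) * (1 / 4 ^ (k + 1)))"
    by (rule ext) (simp add: c_def add_ac)
  ultimately show ?thesis
    using result(1) by simp
qed

end
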